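(* Let $q$ be a prime power and $\mathbb{F}_q$ the finite field with $q$ elements. If $q=2$ or $q=3$, then there are infinitely many pairs $(F,G)$ of nonzero monic polynomials in $\mathbb{F}_q[T]$ with $\varphi(F)=\sigma(G)$. If $q\neq 2,3$, then the only pair $(F,G)$ of nonzero monic polynomials in $\mathbb{F}_q[T]$ with $\varphi(F)=\sigma(G)$ is $F=G=1$.
   Context: For a nonzero $A\in\mathbb{F}_q[T]$ let $|A|=q^{\deg A}$. A "prime" means a monic irreducible polynomial, and $v_P(F)$ is the exponent of the prime $P$ in $F$. For nonzero $F\in\mathbb{F}_q[T]$, $\varphi(F)=\#(\mathbb{F}_q[T]/(F))^*=\prod_{P\mid F}|P|^{v_P(F)-1}(|P|-1)$, the product over primes $P$ dividing $F$, and $\sigma(G)=\sum_{D\mid G}|D|$, the sum over monic divisors $D$ of $G$. *)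

theory Defs
  imports
    "HOL-Library.Cardinality"
    "HOL-Computational_Algebra.Computational_Algebra"
    "HOL-Number_Theory.Cong"
begin

text \<open>\<open>|A| = q ^ deg A\<close> with \<open>q\<close> the size of the coefficient field; only meaningful for
  \<open>A \<noteq> 0\<close>, and only used there.\<close>

definition poly_abs :: "'a :: {field,finite} poly \<Rightarrow> nat" where
  "poly_abs A = CARD('a) ^ degree A"

definition poly_residue_class :: "'a :: {field,finite} poly \<Rightarrow> 'a poly \<Rightarrow> 'a poly set" where
  "poly_residue_class F A = {B. [B = A] (mod F)}"

text \<open>The unit group of the quotient ring modulo \<open>F\<close> consists of the residue classes having a
  multiplicative inverse; for constant \<open>F \<noteq> 0\<close> the quotient is the zero ring, whose single
  element is a unit.\<close>

definition poly_quot_units :: "'a :: {field,finite} poly \<Rightarrow> 'a poly set set" where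
  "poly_quot_units F = {poly_residue_class F A | A. \<exists>B. [A * B = 1] (mod F)}"

definition poly_phi :: "'a :: {field,finite} poly \<Rightarrow> nat" where
  "poly_phi F = card (poly_quot_units F)"

definition poly_sigma :: "'a :: {field,finite} poly \<Rightarrow> nat" where
  "poly_sigma G = (\<Sum>D | D dvd G \<and> lead_coeff D = 1. poly_abs D)"

end

theory Submission
  imports Defs "HOL-Number_Theory.Pocklington"
begin

text \<open>
  Write \<open>q\<close> for the size of the field. Both \<open>\<phi>\<close> and \<open>\<sigma>\<close> are expressed through the numbers
  \<open>q ^ n - 1\<close>: \<open>\<phi>(F)\<close> is a power of \<open>q\<close> times a product with one such factor for each prime dividing
  \<open>F\<close>, while \<open>\<sigma>(G)\<close> is a quotient of two products with equally many factors. Since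
  \<open>\<sigma>(G) \<equiv> 1\<close> modulo \<open>q\<close>, an equation \<open>\<phi>(F) = \<sigma>(G)\<close> forces the power of \<open>q\<close> to be trivial. For
  \<open>q \<ge> 4\<close>, Zsigmondy's theorem shows that two equal products of numbers \<open>q ^ n - 1\<close> have the same number of
  factors, whence \<open>F\<close> has no prime factor at all. This fails for \<open>q = 2\<close>, where \<open>q - 1 = 1\<close>, and for
  \<open>q = 3\<close>, where \<open>q\<^sup>2 - 1 = (q - 1) ^ 3\<close>. There, for a prime \<open>P\<close> of degree \<open>n\<close>,
  \<open>\<phi>(P) = 2 ^ n - 1 = \<sigma>(T ^ (n - 1))\<close> if \<open>q = 2\<close>, and
  \<open>\<phi>(T (T - 1) (T + 1) P) = 8 (3 ^ n - 1) = \<sigma>(T (T - 1) (T + 1) ^ (n - 1))\<close> if \<open>q = 3\<close> and \<open>n \<ge> 2\<close>.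
\<close>

subsection \<open>Irreducible polynomials over a field\<close>

text \<open>The combinations of \<open>P\<close> and \<open>A\<close> form an ideal. By division
  with remainder, a nonzero element \<open>g\<close> of least degree divides all of it, in
  particular \<open>P\<close> and \<open>A\<close>. If \<open>g\<close> were not a unit, it would be
  associated to the irreducible \<open>P\<close>, which does not divide \<open>A\<close>.\<close>

lemma irreducible_poly_bezout:
  fixes P A :: "'a::field poly"
  assumes "irreducible P" "\<not> P dvd A"
  obtains x y where "x * P + y * A = 1"
proof -
  define I where "I = {x * P + y * A |x y. True}"
  have PI: "P \<in> I" unfolding I_def by (rule CollectI, rule exI[of _ 1], rule exI[of _ 0]) simp
  have AI: "A \<in> I" unfolding I_def by (rule CollectI, rule exI[of _ 0], rule exI[of _ 1]) simp
  have "P \<noteq> 0" using assms by auto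
  define g where "g = arg_min degree (\<lambda>g. g \<in> I \<and> g \<noteq> 0)"
  have g: "g \<in> I" "g \<noteq> 0" and min: "\<And>h. h \<in> I \<Longrightarrow> h \<noteq> 0 \<Longrightarrow> degree g \<le> degree h"
    using arg_min_natI[of "\<lambda>g. g \<in> I \<and> g \<noteq> 0" P degree]
      arg_min_nat_le[of "\<lambda>g. g \<in> I \<and> g \<noteq> 0" _ degree] PI \<open>P \<noteq> 0\<close>
    by (auto simp: g_def)
  have lin: "f - c * g \<in> I" if "f \<in> I" for f c
  proof -
    from that g obtain x y x' y' where "f = x * P + y * A" "g = x' * P + y' * A"
      unfolding I_def by blast
    then have "f - c * g = (x - c * x') * P + (y - c * y') * A" by (simp add: algebra_simps)
    then show ?thesis unfolding I_def by blast
  qed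
  have gdvd: "g dvd f" if "f \<in> I" for f
  proof (rule ccontr)
    assume "\<not> g dvd f"
    then have nz: "f mod g \<noteq> 0" by (simp add: mod_eq_0_iff_dvd)
    moreover have "f mod g \<in> I"
      using lin[OF that, of "f div g"] by (simp add: minus_div_mult_eq_mod)
    ultimately show False using min degree_mod_less'[OF g(2) nz] by fastforce
  qed
  obtain c where c: "P = g * c" using gdvd[OF PI] unfolding dvd_def by blast
  have "is_unit g"
  proof (rule ccontr)
    assume "\<not> is_unit g"
    then have "is_unit c" using assms(1) c by (auto dest: irreducibleD)
    then have "P dvd g" using c by (simp add: mult_unit_dvd_iff)
    then show False using gdvd[OF AI] assms(2) dvd_trans by blast
  qed
  then obtain u where u: "1 = g * u" unfolding dvd_def by blast
  from g obtain x y where xy: "g = x * P + y * A" unfolding I_def by blast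
  have "(u * x) * P + (u * y) * A = 1" using u xy by (simp add: algebra_simps)
  then show thesis by (rule that)
qed

lemma dvd_mult_irreducible_poly_cancel:
  fixes P D X :: "'a::field poly"
  assumes "irreducible P" "\<not> P dvd D" "D dvd P * X"
  shows "D dvd X"
proof -
  obtain x y where xy: "x * P + y * D = 1" by (rule irreducible_poly_bezout[OF assms(1,2)])
  have "X = (x * P + y * D) * X" using xy by simp
  also have "\<dots> = x * (P * X) + D * (y * X)" by (simp add: algebra_simps)
  finally show ?thesis using assms(3) by (metis dvd_add dvd_mult dvd_triv_left)
qed

text \<open>A divisor of least positive degree admits no proper factorization; scaling by the
  inverse of its leading coefficient makes it monic.\<close>

lemma monic_irreducible_factor:
  fixes F :: "'a::field poly"
  assumes "degree F > 0"
  obtains P where "irreducible P" "lead_coeff P = 1" "P dvd F"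
proof -
  have "\<exists>P. degree P > 0 \<and> P dvd F" using assms by (intro exI[of _ F]) auto
  then obtain P where P: "degree P > 0" "P dvd F"
      and min: "\<And>Q. degree Q > 0 \<Longrightarrow> Q dvd F \<Longrightarrow> degree P \<le> degree Q"
    using ex_has_least_nat[of "\<lambda>P. degree P > 0 \<and> P dvd F" _ degree] by blast
  have P0: "P \<noteq> 0" using P by auto
  have irr: "irreducible P"
  proof (rule irreducibleI)
    show "P \<noteq> 0" by fact
    show "\<not> is_unit P" using P by (auto simp: is_unit_iff_degree P0)
    fix a b assume ab: "P = a * b"
    with P0 have nz: "a \<noteq> 0" "b \<noteq> 0" by auto
    then have deg: "degree P = degree a + degree b" using ab by (simp add: degree_mult_eq)
    show "is_unit a \<or> is_unit b"
    proof (rule ccontr)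
      assume "\<not> (is_unit a \<or> is_unit b)"
      then have "degree a > 0" "degree b > 0" using nz by (auto simp: is_unit_iff_degree)
      moreover have "a dvd F" using P(2) ab by (auto intro: dvd_mult_left)
      ultimately show False using min[of a] deg by simp
    qed
  qed
  define c where "c = inverse (lead_coeff P)"
  have c: "c \<noteq> 0" using P0 by (simp add: c_def)
  have "Polynomial.smult c P = [:c:] * P" by simp
  moreover have "is_unit [:c:]" using c by (simp add: is_unit_iff_degree)
  ultimately have "irreducible (Polynomial.smult c P)" using irr by (metis irreducible_mult_unit_left)
  moreover have "lead_coeff (Polynomial.smult c P) = 1" using P0 by (simp add: c_def)
  moreover have "Polynomial.smult c P dvd F" using c P(2) by (simp add: smult_dvd_iff)
  ultimately show thesis by (rule that)
qed

lemma monic_degree_0_iff: "lead_coeff F = 1 \<Longrightarrow> degree F = 0 \<longleftrightarrow> F = (1 :: 'a::field poly)"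
  by (metis degree_1 degree_eq_zeroE lead_coeff_pCons(2) one_pCons)

lemma irreducible_poly_degree_pos: "irreducible P \<Longrightarrow> degree (P :: 'a::field poly) > 0"
  using is_unit_iff_degree[of P] by (auto simp: irreducible_def)

section \<open>Counting residues modulo a polynomial\<close>

lemma poly_degree_less_Suc:
  "{A :: 'a::zero poly. A = 0 \<or> degree A < Suc n} =
     (\<lambda>(c, p). pCons c p) ` (UNIV \<times> {A. A = 0 \<or> degree A < n})"
proof (intro Set.set_eqI iffI)
  fix A :: "'a poly"
  assume A: "A \<in> {A. A = 0 \<or> degree A < Suc n}"
  obtain c p where "A = pCons c p" by (rule pCons_cases)
  moreover from this A have "p = 0 \<or> degree p < n" by (auto simp: degree_pCons_eq_if split: if_splits)
  ultimately show "A \<in> (\<lambda>(c, p). pCons c p) ` (UNIV \<times> {A. A = 0 \<or> degree A < n})" by auto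
qed (auto simp: degree_pCons_eq_if split: if_splits)

text \<open>Splitting off the constant coefficient gives a factor \<open>CARD('a)\<close> at each
  step. The alternative \<open>A = 0\<close> matters because the zero polynomial has degree 0: for
  \<open>n = 0\<close> the set is \<open>{0}\<close>, of size 1.\<close>

lemma finite_card_poly_degree_less:
  "finite {A :: 'a::{zero,finite} poly. A = 0 \<or> degree A < n} \<and>
   card {A :: 'a::{zero,finite} poly. A = 0 \<or> degree A < n} = CARD('a) ^ n"
proof (induction n)
  case (Suc n)
  have "inj_on (\<lambda>(c, p). pCons c p) (UNIV \<times> {A :: 'a poly. A = 0 \<or> degree A < n})"
    by (auto simp: inj_on_def)
  with Suc show ?case unfolding poly_degree_less_Suc
    by (simp only: card_image card_cartesian_product finite_imageI finite_cartesian_product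
        finite power_Suc)
qed auto

lemma poly_mod_eq_self_iff:
  assumes "(F :: 'a::field poly) \<noteq> 0"
  shows "A mod F = A \<longleftrightarrow> A = 0 \<or> degree A < degree F"
  using assms by (metis degree_mod_less mod_poly_less mod_0)

lemma finite_poly_residues: "(F :: 'a::{field,finite} poly) \<noteq> 0 \<Longrightarrow> finite {A. A mod F = A}"
  using finite_card_poly_degree_less[where 'a = 'a and n = "degree F"] by (simp add: poly_mod_eq_self_iff)

lemma card_poly_residues:
  "(F :: 'a::{field,finite} poly) \<noteq> 0 \<Longrightarrow> card {A. A mod F = A} = poly_abs F"
  using finite_card_poly_degree_less[where 'a = 'a and n = "degree F"] by (simp add: poly_mod_eq_self_iff poly_abs_def)

lemma card_field_ge_2: "CARD('a::{field,finite}) \<ge> 2"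
proof -
  have "card {0, 1 :: 'a} \<le> CARD('a)" by (rule card_mono) auto
  then show ?thesis by simp
qed

lemma poly_abs_mult:
  "A \<noteq> 0 \<Longrightarrow> B \<noteq> 0 \<Longrightarrow> poly_abs (A * B) = poly_abs A * poly_abs (B :: 'a::{field,finite} poly)"
  by (simp add: poly_abs_def degree_mult_eq power_add)

lemma poly_abs_1 [simp]: "poly_abs 1 = 1"
  by (simp add: poly_abs_def)

text \<open>Euclid's argument: a prime factor of \<open>1 + R\<close> would be among the finitely
  many factors of \<open>R\<close>.\<close>

lemma infinite_monic_irreducible_polys: "infinite {P :: 'a::field poly. irreducible P \<and> lead_coeff P = 1}"
proof
  let ?S = "{P :: 'a poly. irreducible P \<and> lead_coeff P = 1}"
  assume fin: "finite ?S"
  \<comment> \<open>The factor \<open>[:0, 1:]\<close> makes \<open>R\<close> nonconstant whatever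
    \<open>?S\<close> is, so that \<open>1 + R\<close> has a prime factor.\<close>
  define R where "R = [:0, 1:] * (\<Prod>P\<in>?S. P)"
  have "(\<Prod>P\<in>?S. P) \<noteq> 0" using fin by auto
  then have "degree R > 0" unfolding R_def by (subst degree_mult_eq) auto
  then have "degree (1 + R) > 0" using degree_add_eq_right[of 1 R] by simp
  then obtain P where P: "irreducible P" "lead_coeff P = 1" "P dvd 1 + R"
    by (rule monic_irreducible_factor)
  then have "P dvd R" unfolding R_def using fin by (intro dvd_mult dvd_prodI) auto
  then have "P dvd 1" using P(3) by (simp add: dvd_add_left_iff)
  then show False using P(1) by (simp add: irreducible_def)
qed

subsection \<open>The functions \<open>\<phi>\<close> and \<open>\<sigma>\<close>\<close>

definition unit_mod :: "'a::field poly \<Rightarrow> 'a poly \<Rightarrow> bool" where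
  "unit_mod F A \<longleftrightarrow> (\<exists>B. [A * B = 1] (mod F))"

lemma unit_mod_iff: "unit_mod F A \<longleftrightarrow> (\<exists>B C. A * B = 1 + F * C)"
  unfolding unit_mod_def cong_iff_dvd_diff dvd_def by (metis add.commute diff_eq_eq)

lemma unit_mod_cong: "[A = A'] (mod F) \<Longrightarrow> unit_mod F A \<longleftrightarrow> unit_mod F A'"
  unfolding unit_mod_def by (metis cong_scalar_right cong_sym cong_trans)

lemma unit_mod_mod [simp]: "unit_mod F (A mod F) \<longleftrightarrow> unit_mod F A"
  by (rule unit_mod_cong) (simp add: cong_def)

lemma unit_mod_dvd: "unit_mod F A \<Longrightarrow> E dvd F \<Longrightarrow> unit_mod E A"
  unfolding unit_mod_def by (meson cong_dvd_modulus)

lemma unit_mod_prod_iff: "unit_mod (E * F) A \<longleftrightarrow> unit_mod E A \<and> unit_mod F A"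
proof
  assume "unit_mod E A \<and> unit_mod F A"
  then obtain B C b c where "A * B = 1 + E * b" "A * C = 1 + F * c" unfolding unit_mod_iff by blast
  \<comment> \<open>This product is divisible by \<open>E * F\<close>, and expanded it is 1 minus a
    multiple of \<open>A\<close>, which exhibits an inverse of \<open>A\<close> modulo
    \<open>E * F\<close>.\<close>
  then have "(A * B - 1) * (A * C - 1) = (E * F) * (b * c)" by simp
  then have "A * (B + C - A * B * C) = 1 + (E * F) * (- b * c)" by (simp add: algebra_simps)
  then show "unit_mod (E * F) A" unfolding unit_mod_iff by blast
qed (auto intro: unit_mod_dvd)

lemma unit_mod_mult_iff: "unit_mod F (A * B) \<longleftrightarrow> unit_mod F A \<and> unit_mod F B"
proof
  assume "unit_mod F (A * B)"
  then show "unit_mod F A \<and> unit_mod F B" unfolding unit_mod_def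
    by (metis mult.assoc mult.commute)
next
  assume "unit_mod F A \<and> unit_mod F B"
  then obtain C D where "[A * C = 1] (mod F)" "[B * D = 1] (mod F)" unfolding unit_mod_def by blast
  then have "[(A * C) * (B * D) = 1 * 1] (mod F)" by (rule cong_mult)
  then have "[(A * B) * (C * D) = 1] (mod F)" by (simp add: ac_simps)
  then show "unit_mod F (A * B)" unfolding unit_mod_def by blast
qed

lemma unit_mod_irreducible_iff:
  assumes "irreducible P"
  shows "unit_mod P A \<longleftrightarrow> \<not> P dvd A"
proof
  assume "unit_mod P A"
  then obtain B C where "A * B = 1 + P * C" unfolding unit_mod_iff by blast
  then have "1 = A * B - P * C" by simp
  then show "\<not> P dvd A" using assms by (metis dvd_diff dvd_mult2 dvd_triv_left irreducible_not_unit)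
next
  assume "\<not> P dvd A"
  then obtain x y where "x * P + y * A = 1" using irreducible_poly_bezout assms by blast
  then have "A * y = 1 + P * (- x)" by (simp add: algebra_simps)
  then show "unit_mod P A" unfolding unit_mod_iff by blast
qed

text \<open>Every residue class contains exactly one remainder modulo \<open>F\<close>, so counting
  unit classes amounts to counting remainders.\<close>

lemma poly_phi_eq_card_reduced: "poly_phi F = card {A. A mod F = A \<and> unit_mod F A}"
proof -
  have "poly_quot_units F = poly_residue_class F ` {A. A mod F = A \<and> unit_mod F A}"
  proof (intro Set.set_eqI iffI)
    fix X assume "X \<in> poly_quot_units F"
    then obtain A where A: "X = poly_residue_class F A" "unit_mod F A"
      unfolding poly_quot_units_def unit_mod_def by blast
    have "X = poly_residue_class F (A mod F)" using A(1) by (simp add: poly_residue_class_def cong_def)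
    then show "X \<in> poly_residue_class F ` {A. A mod F = A \<and> unit_mod F A}" using A(2) by auto
  qed (auto simp: poly_quot_units_def unit_mod_def)
  moreover have "inj_on (poly_residue_class F) {A. A mod F = A \<and> unit_mod F A}"
  proof (rule inj_onI)
    fix A B assume AB: "A \<in> {A. A mod F = A \<and> unit_mod F A}" "B \<in> {A. A mod F = A \<and> unit_mod F A}"
      "poly_residue_class F A = poly_residue_class F B"
    have "A \<in> poly_residue_class F A" by (simp add: poly_residue_class_def)
    then have "A \<in> poly_residue_class F B" using AB(3) by simp
    then have "[A = B] (mod F)" by (simp add: poly_residue_class_def)
    then show "A = B" using AB(1,2) by (simp add: cong_def)
  qed
  ultimately show ?thesis unfolding poly_phi_def by (simp add: card_image)
qed

text \<open>Division by \<open>F\<close> writes each residue modulo \<open>P * F\<close> uniquely as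
  \<open>B + F * C\<close> with \<open>B\<close> reduced modulo \<open>F\<close> and
  \<open>C\<close> reduced modulo \<open>P\<close>. Being a unit modulo \<open>F\<close> depends on
  \<open>B\<close> alone, so \<open>C\<close> is free.\<close>

lemma card_residues_mult_unit_mod:
  fixes P F :: "'a::{field,finite} poly"
  assumes "P \<noteq> 0" "F \<noteq> 0"
  shows "card {A. A mod (P * F) = A \<and> unit_mod F A} = poly_abs P * poly_phi F"
proof -
  let ?S = "{A. A mod P = A} \<times> {A. A mod F = A \<and> unit_mod F A}"
  let ?f = "\<lambda>(C, B). B + F * C"
  have inj: "inj_on ?f ?S"
  proof (rule inj_onI, clarify)
    fix C B C' B'
    assume *: "B mod F = B" "B' mod F = B'" "B + F * C = B' + F * C'"
    from *(3) have "(B + F * C) mod F = (B' + F * C') mod F" by simp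
    with *(1,2) have "B = B'" by (metis mod_mult_self2)
    with * assms show "C = C' \<and> B = B'" by simp
  qed
  have deg: "degree (P * F) = degree P + degree F" using assms by (simp add: degree_mult_eq)
  have red: "A mod (P * F) = A \<longleftrightarrow> A = 0 \<or> degree A < degree P + degree F" for A
    using assms by (simp add: poly_mod_eq_self_iff deg)
  have "?f ` ?S = {A. A mod (P * F) = A \<and> unit_mod F A}"
  proof (intro Set.set_eqI iffI)
    fix A assume "A \<in> ?f ` ?S"
    then obtain B C where A: "A = B + F * C" "C mod P = C" "B mod F = B" "unit_mod F B" by auto
    have "degree (F * C) < degree P + degree F" if "C \<noteq> 0"
      using that A(2) assms by (simp add: poly_mod_eq_self_iff degree_mult_eq)
    moreover have "B = 0 \<or> degree B < degree P + degree F"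
      using A(3) assms by (auto simp: poly_mod_eq_self_iff)
    ultimately have "A = 0 \<or> degree A < degree P + degree F"
      using A(1) degree_add_less[of B "degree P + degree F" "F * C"] by (cases "B = 0"; cases "C = 0") auto
    moreover have "unit_mod F A \<longleftrightarrow> unit_mod F B" by (rule unit_mod_cong) (simp add: A(1) cong_def)
    ultimately show "A \<in> {A. A mod (P * F) = A \<and> unit_mod F A}" using A(4) red by blast
  next
    fix A assume A: "A \<in> {A. A mod (P * F) = A \<and> unit_mod F A}"
    define B where "B = A mod F"
    define C where "C = A div F"
    have eq: "A = B + F * C" by (simp add: B_def C_def)
    have "C mod P = C"
    proof (rule ccontr)
      assume "C mod P \<noteq> C"
      then have C: "C \<noteq> 0" "degree C \<ge> degree P" using assms by (auto simp: poly_mod_eq_self_iff)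
      then have ge: "degree (F * C) \<ge> degree P + degree F" using assms by (simp add: degree_mult_eq)
      have "B = 0 \<or> degree B < degree F" unfolding B_def using degree_mod_less[OF assms(2)] by blast
      then have "degree A = degree (F * C)" and "A \<noteq> 0"
        using eq ge C(1) assms degree_add_eq_right[of B "F * C"] by auto
      then show False using A red[of A] ge by auto
    qed
    then have "(C, B) \<in> ?S" using A by (simp add: B_def)
    then show "A \<in> ?f ` ?S" using eq by (auto intro!: image_eqI[of _ _ "(C, B)"])
  qed
  then have "card {A. A mod (P * F) = A \<and> unit_mod F A} = card ?S" using card_image[OF inj] by argo
  also have "\<dots> = poly_abs P * poly_phi F"
    using assms by (simp add: card_cartesian_product card_poly_residues poly_phi_eq_card_reduced)
  finally show ?thesis .
qed

text \<open>Since \<open>P\<close> already divides \<open>F\<close>, the units modulo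
  \<open>P * F\<close> are exactly the units modulo \<open>F\<close>, and the preceding count
  applies.\<close>

lemma poly_phi_mult_irreducible_dvd:
  fixes P F :: "'a::{field,finite} poly"
  assumes "irreducible P" "F \<noteq> 0" "P dvd F"
  shows "poly_phi (P * F) = poly_abs P * poly_phi F"
proof -
  have "unit_mod (P * F) A \<longleftrightarrow> unit_mod F A" for A
    using assms(3) unit_mod_dvd by (auto simp: unit_mod_prod_iff)
  then have "poly_phi (P * F) = card {A. A mod (P * F) = A \<and> unit_mod F A}"
    by (simp add: poly_phi_eq_card_reduced)
  also have "\<dots> = poly_abs P * poly_phi F"
    using assms by (intro card_residues_mult_unit_mod) auto
  finally show ?thesis .
qed

text \<open>Among the residues modulo \<open>P * F\<close> that are units modulo \<open>F\<close>,
  those not divisible by \<open>P\<close> are the units modulo \<open>P * F\<close>. The others are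
  \<open>P * B\<close> with \<open>B\<close> a reduced unit modulo \<open>F\<close>, and there are
  \<open>poly_phi F\<close> of them.\<close>

lemma poly_phi_mult_irreducible_not_dvd:
  fixes P F :: "'a::{field,finite} poly"
  assumes "irreducible P" "F \<noteq> 0" "\<not> P dvd F"
  shows "poly_phi (P * F) = (poly_abs P - 1) * poly_phi F"
proof -
  let ?V = "{A. A mod (P * F) = A \<and> unit_mod F A}"
  let ?W = "{A. A mod (P * F) = A \<and> unit_mod (P * F) A}"
  let ?U = "{A. A mod F = A \<and> unit_mod F A}"
  have P0: "P \<noteq> 0" using assms(1) by auto
  have "unit_mod P F" using assms by (simp add: unit_mod_irreducible_iff)
  then obtain B C where "F * B = 1 + P * C" unfolding unit_mod_iff by blast
  \<comment> \<open>The relation inverting \<open>F\<close> modulo \<open>P\<close> also inverts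
    \<open>P\<close> modulo \<open>F\<close>.\<close>
  then have "P * (- C) = 1 + F * (- B)" by (simp add: algebra_simps)
  then have unitP: "unit_mod F P" unfolding unit_mod_iff by blast
  have fin: "finite ?V" "finite ?W"
    using P0 assms(2) by (auto intro: finite_subset[OF _ finite_poly_residues[of "P * F"]])
  have V_eq: "?V = ?W \<union> (*) P ` ?U"
  proof (intro Set.set_eqI iffI)
    fix A assume A: "A \<in> ?V"
    show "A \<in> ?W \<union> (*) P ` ?U"
    proof (cases "P dvd A")
      case True
      then obtain B where B: "A = P * B" unfolding dvd_def by blast
      have "P * (B mod F) = (P * B) mod (P * F)" by (rule mult_mod_right)
      also have "\<dots> = P * B" using A B by blast
      finally have "P * (B mod F) = P * B" .
      then have "B mod F = B" using P0 by simp
      moreover have "unit_mod F B" using A B by (simp add: unit_mod_mult_iff)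
      ultimately show ?thesis using B by blast
    next
      case False
      then show ?thesis using A assms(1) by (simp add: unit_mod_prod_iff unit_mod_irreducible_iff)
    qed
  next
    fix A assume "A \<in> ?W \<union> (*) P ` ?U"
    then show "A \<in> ?V"
      using unitP by (auto simp: unit_mod_prod_iff unit_mod_mult_iff simp flip: mult_mod_right)
  qed
  have disj: "?W \<inter> (*) P ` ?U = {}"
    using assms(1) by (auto simp: unit_mod_prod_iff unit_mod_irreducible_iff)
  have "finite (?W \<union> (*) P ` ?U)" using fin(1) unfolding V_eq .
  then have "finite ((*) P ` ?U)" by simp
  then have "card ?V = card ?W + card ((*) P ` ?U)"
    unfolding V_eq using fin(2) disj by (intro card_Un_disjoint)
  moreover have "card ((*) P ` ?U) = card ?U" using P0 by (intro card_image) (auto simp: inj_on_def)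
  moreover have "card ?V = poly_abs P * poly_phi F"
    using P0 assms(2) by (rule card_residues_mult_unit_mod)
  ultimately have "poly_abs P * poly_phi F = poly_phi (P * F) + poly_phi F"
    by (simp add: poly_phi_eq_card_reduced)
  then show ?thesis by (simp add: diff_mult_distrib)
qed

lemma poly_phi_1 [simp]: "poly_phi (1 :: 'a::{field,finite} poly) = 1"
proof -
  have "{A :: 'a poly. A mod 1 = A \<and> unit_mod 1 A} = {0}" by (auto simp: unit_mod_def)
  then show ?thesis by (simp add: poly_phi_eq_card_reduced)
qed

section \<open>Monic divisors and the values of sigma\<close>

lemma finite_monic_divisors:
  assumes "(G :: 'a::{field,finite} poly) \<noteq> 0"
  shows "finite {D. D dvd G \<and> lead_coeff D = 1}"
proof (rule finite_subset)
  show "{D. D dvd G \<and> lead_coeff D = 1} \<subseteq> {A. A = 0 \<or> degree A < Suc (degree G)}"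
    using dvd_imp_degree_le[OF _ assms] by (auto simp: less_Suc_eq_le)
qed (use finite_card_poly_degree_less[where 'a = 'a] in blast)

lemma monic_divisors_1: "{D :: 'a::field poly. D dvd 1 \<and> lead_coeff D = 1} = {1}"
proof -
  have "D = 1" if "D dvd 1" "lead_coeff D = 1" for D :: "'a poly"
  proof -
    have "D \<noteq> 0" using that(2) by auto
    then show ?thesis using that monic_degree_0_iff[of D] is_unit_iff_degree[of D] by simp
  qed
  then show ?thesis by auto
qed

lemma poly_sigma_1 [simp]: "poly_sigma (1 :: 'a::{field,finite} poly) = 1"
  unfolding poly_sigma_def monic_divisors_1 by simp

lemma dvd_irreducible_power_mult_cancel:
  fixes P D X :: "'a::field poly"
  assumes "irreducible P" "\<not> P dvd D" "D dvd P ^ n * X"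
  shows "D dvd X"
  using assms(3)
proof (induction n)
  case (Suc n)
  then have "D dvd P * (P ^ n * X)" by (simp only: power_Suc mult.assoc)
  then have "D dvd P ^ n * X" by (rule dvd_mult_irreducible_poly_cancel[OF assms(1,2)])
  then show ?case by (rule Suc.IH)
qed simp

text \<open>The monic divisors of \<open>P ^ Suc e * H\<close> not divisible by \<open>P\<close> are
  those of \<open>H\<close>; the remaining ones are \<open>P\<close> times the monic divisors of
  \<open>P ^ e * H\<close>.\<close>

lemma poly_sigma_prime_power_mult_Suc:
  fixes P H :: "'a::{field,finite} poly"
  assumes P: "irreducible P" "lead_coeff P = 1" and H: "H \<noteq> 0" "\<not> P dvd H"
  shows "poly_sigma (P ^ Suc e * H) = poly_sigma H + poly_abs P * poly_sigma (P ^ e * H)"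
proof -
  let ?D = "\<lambda>G. {D. D dvd G \<and> lead_coeff D = 1}"
  have P0: "P \<noteq> 0" using P by auto
  have fin: "finite (?D H)" "finite (?D (P ^ e * H))"
    using P0 H by (auto intro!: finite_monic_divisors)
  have eq: "?D (P ^ Suc e * H) = ?D H \<union> (*) P ` ?D (P ^ e * H)"
  proof (intro Set.set_eqI iffI)
    fix D assume D: "D \<in> ?D (P ^ Suc e * H)"
    show "D \<in> ?D H \<union> (*) P ` ?D (P ^ e * H)"
    proof (cases "P dvd D")
      case True
      then obtain E where E: "D = P * E" unfolding dvd_def by blast
      then have "lead_coeff E = 1" using D P(2) by (simp add: lead_coeff_mult)
      moreover have "P * E dvd P * (P ^ e * H)" using D E by (simp add: mult.assoc)
      then have "E dvd P ^ e * H" using P0 by simp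
      ultimately show ?thesis using E by blast
    next
      case False
      then have "D dvd H" using D P(1) dvd_irreducible_power_mult_cancel by blast
      then show ?thesis using D by simp
    qed
  next
    fix D assume "D \<in> ?D H \<union> (*) P ` ?D (P ^ e * H)"
    then show "D \<in> ?D (P ^ Suc e * H)"
      using P(2) by (auto simp: lead_coeff_mult mult.assoc)
  qed
  have disj: "?D H \<inter> (*) P ` ?D (P ^ e * H) = {}"
    using H(2) by (auto dest: dvd_mult_left)
  have "poly_sigma (P ^ Suc e * H) = poly_sigma H + (\<Sum>D\<in>(*) P ` ?D (P ^ e * H). poly_abs D)"
    unfolding poly_sigma_def eq using fin disj by (intro sum.union_disjoint) auto
  also have "(\<Sum>D\<in>(*) P ` ?D (P ^ e * H). poly_abs D) = (\<Sum>D\<in>?D (P ^ e * H). poly_abs (P * D))"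
    using P0 by (subst sum.reindex) (auto simp: inj_on_def)
  also have "\<dots> = (\<Sum>D\<in>?D (P ^ e * H). poly_abs P * poly_abs D)"
    using P0 by (intro sum.cong refl poly_abs_mult) auto
  also have "\<dots> = poly_abs P * poly_sigma (P ^ e * H)"
    unfolding poly_sigma_def by (simp add: sum_distrib_left)
  finally show ?thesis .
qed

lemma poly_abs_ge_1: "poly_abs (P :: 'a::{field,finite} poly) \<ge> 1"
  using card_field_ge_2[where 'a = 'a] by (simp add: poly_abs_def)

text \<open>The recursion above sums to a geometric series in \<open>poly_abs P\<close>, stated here
  without division.\<close>

lemma poly_sigma_prime_power_mult:
  fixes P H :: "'a::{field,finite} poly"
  assumes "irreducible P" "lead_coeff P = 1" "H \<noteq> 0" "\<not> P dvd H"
  shows "poly_sigma (P ^ e * H) * (poly_abs P - 1) = (poly_abs P ^ Suc e - 1) * poly_sigma H"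
proof -
  obtain k where k: "poly_abs P = Suc k" using poly_abs_ge_1[of P] by (cases "poly_abs P") auto
  \<comment> \<open>With \<open>poly_abs P = Suc k\<close> the claim takes a form free of truncated
    subtraction, in which passing from \<open>e\<close> to \<open>Suc e\<close> multiplies both
    sides by \<open>Suc k\<close>.\<close>
  have "poly_sigma (P ^ e * H) * k + poly_sigma H = Suc k ^ Suc e * poly_sigma H"
  proof (induction e)
    case (Suc e)
    have "poly_sigma (P ^ Suc e * H) * k + poly_sigma H =
        Suc k * (poly_sigma (P ^ e * H) * k + poly_sigma H)"
      unfolding poly_sigma_prime_power_mult_Suc[OF assms] k by (simp add: algebra_simps)
    then show ?case unfolding Suc by (simp add: algebra_simps)
  qed simp
  then show ?thesis unfolding k diff_mult_distrib by simp
qed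

text \<open>The divisor 1 contributes 1, and every other monic divisor has positive degree and so
  contributes a multiple of \<open>CARD('a)\<close>.\<close>

lemma poly_sigma_cong_1:
  fixes G :: "'a::{field,finite} poly"
  assumes "G \<noteq> 0"
  obtains m where "poly_sigma G = 1 + CARD('a) * m"
proof -
  let ?D = "{D. D dvd G \<and> lead_coeff D = 1}"
  have "poly_sigma G = poly_abs (1 :: 'a poly) + (\<Sum>D\<in>?D - {1}. poly_abs D)"
    unfolding poly_sigma_def using finite_monic_divisors[OF assms] by (intro sum.remove) auto
  moreover have "CARD('a) dvd (\<Sum>D\<in>?D - {1}. poly_abs D)"
  proof (rule dvd_sum)
    fix D assume "D \<in> ?D - {1}"
    then have "degree D > 0" using monic_degree_0_iff[of D] by auto
    then show "CARD('a) dvd poly_abs D" unfolding poly_abs_def by (rule dvd_power[OF disjI1])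
  qed
  then obtain m where "(\<Sum>D\<in>?D - {1}. poly_abs D) = CARD('a) * m" unfolding dvd_def by blast
  ultimately show thesis using that by simp
qed

lemma poly_sigma_eq_1_iff:
  fixes G :: "'a::{field,finite} poly"
  assumes "lead_coeff G = 1"
  shows "poly_sigma G = 1 \<longleftrightarrow> G = 1"
proof
  assume sigma: "poly_sigma G = 1"
  show "G = 1"
  proof (rule ccontr)
    assume "G \<noteq> 1"
    have "G \<noteq> 0" using assms by auto
    have "(\<Sum>D\<in>{1, G}. poly_abs D) \<le> poly_sigma G"
      unfolding poly_sigma_def using assms finite_monic_divisors[OF \<open>G \<noteq> 0\<close>]
      by (intro sum_mono2) auto
    then show False using sigma \<open>G \<noteq> 1\<close> poly_abs_ge_1[of G] by simp
  qed
qed simp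

section \<open>Expressing phi and sigma through numbers \<open>q ^ n - 1\<close>\<close>

lemma irreducible_power_decomposition:
  fixes P G :: "'a::field poly"
  assumes "irreducible P" "G \<noteq> 0"
  obtains e H where "G = P ^ e * H" "\<not> P dvd H"
proof -
  have "\<exists>e H. G = P ^ e * H \<and> \<not> P dvd H" using assms(2)
  proof (induction "degree G" arbitrary: G rule: less_induct)
    case less
    show ?case
    proof (cases "P dvd G")
      case True
      then obtain G' where G': "G = P * G'" unfolding dvd_def by blast
      then have "G' \<noteq> 0" using less.prems by auto
      moreover have "degree G' < degree G"
        using G' less.prems irreducible_poly_degree_pos[OF assms(1)] by (simp add: degree_mult_eq)
      ultimately obtain e H where "G' = P ^ e * H" "\<not> P dvd H" using less.hyps by blast
      then have "G = P ^ Suc e * H \<and> \<not> P dvd H" using G' by (simp add: mult.assoc)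
      then show ?thesis by blast
    next
      case False
      then have "G = P ^ 0 * G \<and> \<not> P dvd G" by simp
      then show ?thesis by blast
    qed
  qed
  then show thesis using that by blast
qed

text \<open>Prime factors are removed one at a time. A prime that still divides the cofactor
  contributes only a power of \<open>CARD('a)\<close>; its last copy adds its degree to
  \<open>K\<close>. So \<open>K\<close> collects the degrees of the distinct primes dividing
  \<open>F\<close>.\<close>

lemma poly_phi_eq_prod:
  fixes F :: "'a::{field,finite} poly"
  assumes "lead_coeff F = 1"
  shows "\<exists>s K. poly_phi F = CARD('a) ^ s * (\<Prod>n\<in>#K. CARD('a) ^ n - 1) \<and>
           (\<forall>n\<in>#K. n > 0) \<and> (K = {#} \<longrightarrow> F = 1)"
  using assms
proof (induction "degree F" arbitrary: F rule: less_induct)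
  case less
  show ?case
  proof (cases "F = 1")
    case True
    then show ?thesis by (intro exI[of _ 0] exI[of _ "{#}"]) simp
  next
    case False
    then have "degree F > 0" using less.prems monic_degree_0_iff[of F] by auto
    then obtain P where P: "irreducible P" "lead_coeff P = 1" "P dvd F"
      by (rule monic_irreducible_factor)
    then obtain F' where F': "F = P * F'" unfolding dvd_def by blast
    have monic: "lead_coeff F' = 1" using less.prems P(2) F' by (simp add: lead_coeff_mult)
    then have "F' \<noteq> 0" by auto
    have degP: "degree P > 0" using P(1) by (rule irreducible_poly_degree_pos)
    then have "degree F' < degree F" using F' \<open>F' \<noteq> 0\<close> P(1) by (subst F', subst degree_mult_eq) auto
    then obtain s K where IH: "poly_phi F' = CARD('a) ^ s * (\<Prod>n\<in>#K. CARD('a) ^ n - 1)"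
      "\<forall>n\<in>#K. n > 0" "K = {#} \<longrightarrow> F' = 1"
      using less.hyps monic by blast
    show ?thesis
    proof (cases "P dvd F'")
      case True
      then have "F' \<noteq> 1" using P(1) by (auto simp: irreducible_def)
      moreover have "poly_phi F = CARD('a) ^ (degree P + s) * (\<Prod>n\<in>#K. CARD('a) ^ n - 1)"
        using poly_phi_mult_irreducible_dvd[OF P(1) \<open>F' \<noteq> 0\<close> True] F' IH(1)
        by (simp add: poly_abs_def power_add)
      ultimately show ?thesis using IH(2,3) by blast
    next
      case False
      then have "poly_phi F = CARD('a) ^ s * (\<Prod>n\<in>#add_mset (degree P) K. CARD('a) ^ n - 1)"
        using poly_phi_mult_irreducible_not_dvd[OF P(1) \<open>F' \<noteq> 0\<close> False] F' IH(1)
        by (simp add: poly_abs_def)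
      moreover have "\<forall>n\<in>#add_mset (degree P) K. n > 0" using IH(2) degP by simp
      ultimately show ?thesis by (metis add_mset_not_empty)
    qed
  qed
qed

text \<open>Each exact prime power \<open>P ^ e\<close> in \<open>G\<close> contributes a quotient
  of two numbers \<open>q ^ n - 1\<close>, with exponents \<open>degree P * Suc e\<close> above and
  \<open>degree P\<close> below. \<open>B\<close> collects the former and \<open>A\<close> the
  latter, whence the equal sizes.\<close>

lemma poly_sigma_eq_prod_quotient:
  fixes G :: "'a::{field,finite} poly"
  assumes "lead_coeff G = 1"
  shows "\<exists>A B. poly_sigma G * (\<Prod>n\<in>#A. CARD('a) ^ n - 1) = (\<Prod>n\<in>#B. CARD('a) ^ n - 1) \<and>
           (\<forall>n\<in>#A + B. n > 0) \<and> size A = size B"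
  using assms
proof (induction "degree G" arbitrary: G rule: less_induct)
  case less
  show ?case
  proof (cases "G = 1")
    case True
    then show ?thesis by (intro exI[of _ "{#}"]) simp
  next
    case False
    then have "degree G > 0" using less.prems monic_degree_0_iff[of G] by auto
    then obtain P where P: "irreducible P" "lead_coeff P = 1" "P dvd G"
      by (rule monic_irreducible_factor)
    have "G \<noteq> 0" using less.prems by auto
    with P(1) obtain e H where H: "G = P ^ e * H" "\<not> P dvd H"
      by (rule irreducible_power_decomposition)
    have H0: "H \<noteq> 0" using H(2) by auto
    have e: "e > 0" using H P(3) by (cases e) auto
    have monic: "lead_coeff H = 1"
      using less.prems P(2) H(1) by (simp add: lead_coeff_mult lead_coeff_power)
    have degP: "degree P > 0" using P(1) by (rule irreducible_poly_degree_pos)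
    have "P \<noteq> 0" using P(1) by auto
    then have "degree G = e * degree P + degree H"
      unfolding H(1) using H0 by (simp add: degree_mult_eq degree_power_eq)
    then have "degree H < degree G" using e degP by simp
    then obtain A B where IH: "poly_sigma H * (\<Prod>n\<in>#A. CARD('a) ^ n - 1) = (\<Prod>n\<in>#B. CARD('a) ^ n - 1)"
      "\<forall>n\<in>#A + B. n > 0" "size A = size B"
      using less.hyps monic by blast
    let ?A = "add_mset (degree P) A" and ?B = "add_mset (degree P * Suc e) B"
    have "poly_sigma G * (CARD('a) ^ degree P - 1) = (CARD('a) ^ (degree P * Suc e) - 1) * poly_sigma H"
      using poly_sigma_prime_power_mult[OF P(1,2) H0 H(2), of e] unfolding H(1) poly_abs_def
      by (simp only: power_mult)
    then have "poly_sigma G * (\<Prod>n\<in>#?A. CARD('a) ^ n - 1) =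
        (CARD('a) ^ (degree P * Suc e) - 1) * (poly_sigma H * (\<Prod>n\<in>#A. CARD('a) ^ n - 1))"
      by (simp add: mult.assoc[symmetric])
    also have "\<dots> = (\<Prod>n\<in>#?B. CARD('a) ^ n - 1)" unfolding IH(1) by simp
    finally have "poly_sigma G * (\<Prod>n\<in>#?A. CARD('a) ^ n - 1) = (\<Prod>n\<in>#?B. CARD('a) ^ n - 1)" .
    moreover have "\<forall>n\<in>#?A + ?B. n > 0" using IH(2) degP by auto
    moreover have "size ?A = size ?B" using IH(3) by simp
    ultimately show ?thesis by blast
  qed
qed

section \<open>Infinite families over the fields with two and three elements\<close>

lemma poly_phi_irreducible:
  "irreducible P \<Longrightarrow> poly_phi P = poly_abs (P :: 'a::{field,finite} poly) - 1"
  using poly_phi_mult_irreducible_not_dvd[of P 1] irreducible_not_unit[of P] by simp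

lemma poly_sigma_irreducible_power:
  fixes P :: "'a::{field,finite} poly"
  assumes "irreducible P" "lead_coeff P = 1"
  shows "poly_sigma (P ^ e) * (poly_abs P - 1) = poly_abs P ^ Suc e - 1"
  using poly_sigma_prime_power_mult[OF assms, of 1 e] irreducible_not_unit[OF assms(1)] by simp

lemma infinite_phi_sigma_pairs_card_2:
  assumes "CARD('a::{field,finite}) = 2"
  shows "infinite {(F, G) :: 'a poly \<times> 'a poly |F G.
           F \<noteq> 0 \<and> G \<noteq> 0 \<and> lead_coeff F = 1 \<and> lead_coeff G = 1 \<and> poly_phi F = poly_sigma G}"
proof -
  define f :: "'a poly \<Rightarrow> 'a poly \<times> 'a poly" where "f = (\<lambda>P. (P, [:0, 1:] ^ (degree P - 1)))"
  let ?S = "{P :: 'a poly. irreducible P \<and> lead_coeff P = 1}"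
  \<comment> \<open>The first component of \<open>f P\<close> is \<open>P\<close> itself.\<close>
  have "inj_on f ?S" by (auto simp: inj_on_def f_def)
  then have inf: "infinite (f ` ?S)" using infinite_monic_irreducible_polys by (metis finite_imageD)
  have "f ` ?S \<subseteq> {(F, G) |F G.
           F \<noteq> 0 \<and> G \<noteq> 0 \<and> lead_coeff F = 1 \<and> lead_coeff G = 1 \<and> poly_phi F = poly_sigma G}"
  proof (rule image_subsetI)
    fix P assume "P \<in> ?S"
    then have P: "irreducible P" "lead_coeff P = 1" by auto
    have "degree P > 0" using P(1) by (rule irreducible_poly_degree_pos)
    then have "poly_sigma ([:0, 1:] ^ (degree P - 1) :: 'a poly) = 2 ^ degree P - 1"
      using poly_sigma_irreducible_power[of "[:0, 1:] :: 'a poly" "degree P - 1"] assms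
      by (simp add: irreducible_linear_field_poly poly_abs_def)
    then have "poly_phi P = poly_sigma ([:0, 1:] ^ (degree P - 1) :: 'a poly)"
      using poly_phi_irreducible[OF P(1)] assms by (simp add: poly_abs_def)
    then show "f P \<in> {(F, G) |F G.
           F \<noteq> 0 \<and> G \<noteq> 0 \<and> lead_coeff F = 1 \<and> lead_coeff G = 1 \<and> poly_phi F = poly_sigma G}"
      unfolding f_def using P by (auto simp: lead_coeff_power)
  qed
  then show ?thesis using inf infinite_super by blast
qed

lemma infinite_phi_sigma_pairs_card_3:
  assumes "CARD('a::{field,finite}) = 3"
  shows "infinite {(F, G) :: 'a poly \<times> 'a poly |F G.
           F \<noteq> 0 \<and> G \<noteq> 0 \<and> lead_coeff F = 1 \<and> lead_coeff G = 1 \<and> poly_phi F = poly_sigma G}"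
proof -
  have "card {0, 1 :: 'a} < CARD('a)" using assms by simp
  then have "{0, 1 :: 'a} \<noteq> UNIV" by (metis less_irrefl)
  \<comment> \<open>\<open>c\<close> is the third element of the field, that is -1, so
    \<open>L 0\<close>, \<open>L 1\<close> and \<open>L c\<close> are the three monic linear
    polynomials.\<close>
  then obtain c :: 'a where c: "c \<noteq> 0" "c \<noteq> 1" by blast
  define L :: "'a \<Rightarrow> 'a poly" where "L = (\<lambda>a. [:-a, 1:])"
  have irr: "irreducible (L a)" and monic: "lead_coeff (L a) = 1" and abs: "poly_abs (L a) = 3"
    and nz: "L a \<noteq> 0" and deg: "degree (L a) = 1" for a
    using assms by (simp_all add: L_def irreducible_linear_field_poly poly_abs_def)
  have dvd_iff: "L a dvd p \<longleftrightarrow> poly p a = 0" for a p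
    by (simp add: L_def poly_eq_0_iff_dvd)
  have poly_L: "poly (L a) b = b - a" for a b by (simp add: L_def)
  define f :: "'a poly \<Rightarrow> 'a poly \<times> 'a poly"
    where "f = (\<lambda>P. (L 0 * (L 1 * (L c * P)), L 0 ^ 1 * (L 1 ^ 1 * L c ^ (degree P - 1))))"
  \<comment> \<open>Excluding degree below 2 removes only finitely many primes and keeps
    \<open>P\<close> distinct from the three linear factors.\<close>
  let ?S = "{P :: 'a poly. irreducible P \<and> lead_coeff P = 1} - {A. A = 0 \<or> degree A < 2}"
  have "infinite ?S"
    using infinite_monic_irreducible_polys finite_card_poly_degree_less[where 'a = 'a and n = 2]
    by (intro Diff_infinite_finite) auto
  moreover have "inj_on f ?S" using nz by (auto simp: inj_on_def f_def)
  ultimately have inf: "infinite (f ` ?S)" using finite_imageD by blast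
  have "f ` ?S \<subseteq> {(F, G) |F G.
           F \<noteq> 0 \<and> G \<noteq> 0 \<and> lead_coeff F = 1 \<and> lead_coeff G = 1 \<and> poly_phi F = poly_sigma G}"
  proof (rule image_subsetI)
    fix P assume "P \<in> ?S"
    then have P: "irreducible P" "lead_coeff P = 1" "P \<noteq> 0" "degree P \<ge> 2" by auto
    have not_dvd: "\<not> L a dvd P" for a
    proof
      assume "L a dvd P"
      then obtain Q where Q: "P = L a * Q" unfolding dvd_def by blast
      then have "is_unit Q" using P(1) irr[of a] by (auto simp: irreducible_def)
      moreover have "Q \<noteq> 0" using Q P(3) by auto
      ultimately have "degree Q = 0" using is_unit_iff_degree by blast
      then have "degree P = 1" using degree_mult_eq[OF nz[of a] \<open>Q \<noteq> 0\<close>] deg Q by simp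
      then show False using P(4) by simp
    qed
    have roots: "poly P a \<noteq> 0" for a using not_dvd[of a] by (simp add: dvd_iff)
    \<comment> \<open>Each linear factor contributes 3 - 1 = 2, and \<open>P\<close> contributes
      \<open>3 ^ degree P - 1\<close>.\<close>
    have "poly_phi (L 0 * (L 1 * (L c * P))) = 8 * (3 ^ degree P - 1)"
      using c nz P roots assms
      by (simp add: poly_phi_mult_irreducible_not_dvd irr abs dvd_iff poly_L poly_phi_irreducible
          poly_abs_def[of P])
    moreover have "poly_sigma (L 0 ^ 1 * (L 1 ^ 1 * L c ^ (degree P - 1))) = 8 * (3 ^ degree P - 1)"
    proof -
      \<comment> \<open>The factors \<open>L 0\<close> and \<open>L 1\<close> contribute (9 - 1) / 2
        = 4 each, and the power of \<open>L c\<close> contributes half of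
        \<open>3 ^ degree P - 1\<close>.\<close>
      let ?Z = "L c ^ (degree P - 1)"
      have "poly_sigma (L 0 ^ 1 * (L 1 ^ 1 * ?Z)) * 2 = 8 * poly_sigma (L 1 ^ 1 * ?Z)"
        using poly_sigma_prime_power_mult[OF irr monic, of "L 1 ^ 1 * ?Z" 0 1] c nz
        by (simp add: abs dvd_iff poly_L)
      moreover have "poly_sigma (L 1 ^ 1 * ?Z) * 2 = 8 * poly_sigma ?Z"
        using poly_sigma_prime_power_mult[OF irr monic, of ?Z 1 1] c nz
        by (simp add: abs dvd_iff poly_L)
      moreover have "poly_sigma ?Z * 2 = 3 ^ degree P - 1"
        using poly_sigma_irreducible_power[OF irr monic, of c "degree P - 1"] P(4)
        by (simp add: abs flip: power_Suc)
      ultimately show ?thesis by simp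
    qed
    ultimately have "poly_phi (fst (f P)) = poly_sigma (snd (f P))" by (simp add: f_def)
    moreover have "lead_coeff (fst (f P)) = 1" "lead_coeff (snd (f P)) = 1"
      unfolding f_def using monic P(2) by (simp_all add: lead_coeff_mult lead_coeff_power)
    ultimately show "f P \<in> {(F, G) |F G.
           F \<noteq> 0 \<and> G \<noteq> 0 \<and> lead_coeff F = 1 \<and> lead_coeff G = 1 \<and> poly_phi F = poly_sigma G}"
      by (cases "f P") auto
  qed
  then show ?thesis using inf infinite_super by blast
qed

subsection \<open>Primitive prime divisors\<close>

text \<open>Over the complex numbers \<open>p\<close> splits into linear factors, and each factor
  has norm at least \<open>x - 1\<close> at \<open>x\<close> by the triangle inequality.\<close>

lemma norm_poly_ge_if_roots_in_unit_disc:
  fixes p :: "complex poly" and x :: real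
  assumes "p \<noteq> 0" "\<And>z. poly p z = 0 \<Longrightarrow> norm z \<le> 1" "norm (lead_coeff p) \<ge> 1" "x \<ge> 1"
  shows "norm (poly p (of_real x)) \<ge> (x - 1) ^ degree p"
proof -
  obtain A where A: "size A = degree p" "p = Polynomial.smult (lead_coeff p) (\<Prod>z\<in>#A. [:-z, 1:])"
    using alg_closed_imp_factorization[OF assms(1)] by blast
  have "norm z \<le> 1" if "z \<in># A" for z
  proof (rule assms(2))
    have "poly (\<Prod>z\<in>#A. [:-z, 1:]) z = 0" using that by (auto simp: poly_prod_mset)
    then show "poly p z = 0" by (subst A(2)) simp
  qed
  then have "(x - 1) ^ size A \<le> norm (poly (\<Prod>z\<in>#A. [:-z, 1:]) (of_real x))"
  proof (induction A)
    case (add z A)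
    have "x - 1 \<le> norm (of_real x :: complex) - norm z" using add.prems[of z] assms(4) by simp
    also have "\<dots> \<le> norm (of_real x - z)" by (rule norm_triangle_ineq2)
    finally have "x - 1 \<le> norm (of_real x - z)" .
    moreover have "(x - 1) ^ size A \<le> norm (poly (\<Prod>z\<in>#A. [:-z, 1:]) (of_real x))"
      using add by simp
    ultimately have "(x - 1) * (x - 1) ^ size A \<le>
        norm (of_real x - z) * norm (poly (\<Prod>z\<in>#A. [:-z, 1:]) (of_real x))"
      using assms(4) by (intro mult_mono) auto
    then show ?case by (simp add: algebra_simps flip: norm_mult)
  qed simp
  also have "\<dots> \<le> norm (lead_coeff p) * norm (poly (\<Prod>z\<in>#A. [:-z, 1:]) (of_real x))"
    using assms(3) by (simp add: mult_le_cancel_right1)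
  also have "\<dots> = norm (poly p (of_real x))"
    by (subst (3) A(2)) (simp add: norm_mult)
  finally show ?thesis by (simp add: A(1))
qed

lemma ex_primitive_complex_root_of_unity:
  assumes "N > 0"
  obtains z :: complex where "\<And>j. z ^ j = 1 \<longleftrightarrow> N dvd j"
proof
  define z where "z = cis (2 * pi / real N)"
  fix j
  have zN: "z ^ N = 1" using assms by (simp add: z_def DeMoivre)
  have "z ^ j = z ^ (N * (j div N) + j mod N)" by simp
  also have "\<dots> = z ^ (j mod N)" unfolding power_add power_mult zN by simp
  also have "\<dots> = cis (2 * pi * real (j mod N) / real N)" by (simp add: z_def DeMoivre mult.commute)
  finally have zj: "z ^ j = cis (2 * pi * real (j mod N) / real N)" .
  have inj: "inj_on (\<lambda>k. cis (2 * pi * real k / real N)) {..<N}"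
    using bij_betw_roots_unity[OF assms] by (rule bij_betw_imp_inj_on)
  show "z ^ j = 1 \<longleftrightarrow> N dvd j"
  proof
    assume "z ^ j = 1"
    then have "cis (2 * pi * real (j mod N) / real N) = cis (2 * pi * real 0 / real N)"
      using zj by simp
    then have "j mod N = 0" using assms by (intro inj_onD[OF inj]) auto
    then show "N dvd j" by auto
  next
    assume "N dvd j"
    then show "z ^ j = 1" using zj by simp
  qed
qed

lemma map_poly_of_int_mult:
  "map_poly (of_int :: int \<Rightarrow> 'a::comm_ring_1) (p * r) = map_poly of_int p * map_poly of_int r"
  by (intro poly_eqI) (simp add: coeff_map_poly coeff_mult)

lemma map_poly_of_int_diff:
  "map_poly (of_int :: int \<Rightarrow> 'a::comm_ring_1) (p - r) = map_poly of_int p - map_poly of_int r"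
  by (intro poly_eqI) (simp add: coeff_map_poly)

lemma map_poly_of_int_power:
  "map_poly (of_int :: int \<Rightarrow> 'a::comm_ring_1) (p ^ n) = map_poly of_int p ^ n"
  by (induction n) (simp_all add: map_poly_of_int_mult)

lemma map_poly_of_int_dvd:
  "p dvd r \<Longrightarrow> map_poly (of_int :: int \<Rightarrow> 'a::comm_ring_1) p dvd map_poly of_int r"
  by (auto simp: dvd_def map_poly_of_int_mult)

lemma poly_map_poly_of_int:
  "poly (map_poly (of_int :: int \<Rightarrow> 'a::comm_ring_1) p) (of_int x) = of_int (poly p x)"
  by (induction p) (auto simp: map_poly_pCons)

lemma X_power_minus_1_dvd:
  assumes "m dvd n"
  shows "[:0, 1:] ^ m - 1 dvd ([:0, 1:] ^ n - 1 :: int poly)"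
proof -
  obtain k where "n = m * k" using assms by blast
  then show ?thesis by (simp add: power_mult power_diff_1_eq)
qed

text \<open>The number \<open>a\<close> is, up to sign, the value at \<open>q\<close> of the \<open>N\<close>-th cyclotomic polynomial, obtained as
  the quotient \<open>Q\<close> of \<open>X ^ N - 1\<close> by the least common multiple of the \<open>X ^ (N / r) - 1\<close>.\<close>

lemma ex_cyclotomic_value:
  fixes q N :: nat
  assumes N: "N \<ge> 2" and q: "q \<ge> 2"
  obtains a :: int where "real_of_int \<bar>a\<bar> \<ge> (real q - 1) ^ totient N" "a dvd int q ^ N - 1"
    "\<And>r. prime r \<Longrightarrow> r dvd N \<Longrightarrow> a dvd (\<Sum>i<r. (int q ^ (N div r)) ^ i)"
proof -
  define f where "f = (\<lambda>n. [:0, 1:] ^ n - 1 :: int poly)"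
  have deg_f: "degree (f n) = n" and lead_f: "lead_coeff (f n) = 1" if "n > 0" for n
  proof -
    have deg: "degree (- 1 :: int poly) < degree ([:0, 1 :: int:] ^ n)"
      using that by (simp add: degree_power_eq)
    have f: "f n = - 1 + [:0, 1:] ^ n" by (simp add: f_def)
    show "degree (f n) = n"
      unfolding f using degree_add_eq_right[OF deg] by (simp add: degree_power_eq)
    show "lead_coeff (f n) = 1"
      unfolding f using lead_coeff_add_le[OF deg] by (simp add: lead_coeff_power)
  qed
  have f0: "f n \<noteq> 0" if "n > 0" for n using lead_f[OF that] by auto
  define g where "g = (map_poly of_int :: int poly \<Rightarrow> complex poly)"
  have poly_g_f: "poly (g (f n)) z = z ^ n - 1" for n z
  proof -
    have "g (f n) = [:0, 1:] ^ n - 1"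
      by (simp add: f_def g_def map_poly_of_int_diff map_poly_of_int_power map_poly_pCons)
    then show ?thesis by simp
  qed
  define M where "M = Lcm ((\<lambda>r. f (N div r)) ` prime_factors N)"
  have "M dvd f N"
    unfolding M_def f_def using N
    by (auto intro!: Lcm_least X_power_minus_1_dvd simp: prime_factors_dvd)
  then obtain Q where Q: "f N = M * Q" unfolding dvd_def by blast
  have dvdM: "f (N div r) dvd M" if "prime r" "r dvd N" for r
    unfolding M_def using that N by (auto intro!: dvd_Lcm simp: prime_factors_dvd)
  \<comment> \<open>This multiple of \<open>M\<close> is easy to evaluate; it will show that
    \<open>M\<close> does not vanish at primitive \<open>N\<close>-th roots of unity.\<close>
  have Mdvd: "M dvd (\<Prod>r\<in>prime_factors N. f (N div r))"
    unfolding M_def by (auto intro!: Lcm_least dvd_prodI)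
  have nz: "M \<noteq> 0" "Q \<noteq> 0" using Q f0[of N] N by auto
  have gQ: "z ^ N - 1 = poly (g M) z * poly (g Q) z" for z
    using Q poly_g_f[of N z] by (simp add: g_def map_poly_of_int_mult)
  have degQ: "degree (g Q) = degree Q" unfolding g_def by (intro degree_map_poly) auto
  have gQ0: "g Q \<noteq> 0" unfolding g_def using nz by (simp add: map_poly_eq_0_iff)
  have "lead_coeff M * lead_coeff Q = 1" using Q lead_f[of N] N by (simp add: lead_coeff_mult)
  then have "lead_coeff Q * lead_coeff M = 1" by (simp only: mult.commute)
  then have leadQ: "\<bar>lead_coeff Q\<bar> = 1" using zmult_eq_1_iff[of "lead_coeff Q"] by auto
  have norm_lead: "norm (lead_coeff (g Q)) \<ge> 1"
    unfolding degQ using leadQ by (simp add: g_def coeff_map_poly)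
  have roots: "norm z \<le> 1" if "poly (g Q) z = 0" for z
  proof -
    have "z ^ N = 1" using gQ[of z] that by simp
    then have "norm z ^ N = 1 ^ N" by (simp flip: norm_power)
    then have "norm z = 1" using N power_eq_imp_eq_base[of "norm z" N 1] by simp
    then show ?thesis by simp
  qed
  \<comment> \<open>The powers \<open>z ^ k\<close> with \<open>k\<close> coprime to
    \<open>N\<close> are distinct primitive \<open>N\<close>-th roots of unity. None is a root of
    any \<open>f (N div r)\<close>, hence none of \<open>M\<close>, so all are roots of
    \<open>Q\<close>.\<close>
  have deg_ge: "totient N \<le> degree (g Q)"
  proof -
    obtain z :: complex where z: "\<And>j. z ^ j = 1 \<longleftrightarrow> N dvd j"
      using ex_primitive_complex_root_of_unity[of N] N by auto
    have z0: "z \<noteq> 0" using z[of N] N by (auto simp: power_0_left)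
    have "inj_on (\<lambda>k. z ^ k) (totatives N)"
    proof (rule linorder_inj_onI)
      fix i j assume ij: "i < j" "i \<in> totatives N" "j \<in> totatives N"
      show "z ^ i \<noteq> z ^ j"
      proof
        assume "z ^ i = z ^ j"
        then have "z ^ (j - i) = 1" using ij(1) z0 by (simp add: power_diff)
        then have "N dvd j - i" using z by simp
        then have "N \<le> j - i" using ij(1) by (intro dvd_imp_le) auto
        then show False using ij N totatives_le[OF ij(3)] zero_not_in_totatives[of N]
          by (cases "i = 0") auto
      qed
    qed auto
    then have "totient N = card ((\<lambda>k. z ^ k) ` totatives N)"
      by (simp add: card_image totient_def)
    also have "\<dots> \<le> card {z. poly (g Q) z = 0}"
    proof (intro card_mono poly_roots_finite gQ0 subsetI, clarify)
      fix k assume k: "k \<in> totatives N"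
      have zk: "(z ^ k) ^ j = 1 \<longleftrightarrow> N dvd j" for j
        using z[of "k * j"] k
        by (simp add: power_mult in_totatives_iff coprime_dvd_mult_right_iff coprime_commute)
      have "poly (g (\<Prod>r\<in>prime_factors N. f (N div r))) (z ^ k) \<noteq> 0"
      proof -
        have "poly (g (\<Prod>r\<in>S. f (N div r))) (z ^ k) = (\<Prod>r\<in>S. (z ^ k) ^ (N div r) - 1)"
          if "finite S" for S
          using that
        proof (induction S)
          case (insert r S)
          then show ?case using poly_g_f[of "N div r" "z ^ k"]
            by (simp add: g_def map_poly_of_int_mult)
        qed (simp add: g_def)
        moreover have "(z ^ k) ^ (N div r) \<noteq> 1" if "r \<in> prime_factors N" for r
        proof -
          have r: "prime r" "r dvd N" using that by (auto simp: prime_factors_dvd)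
          then have "N div r > 0" using N
            by (auto simp: div_greater_zero_iff dvd_imp_le prime_gt_0_nat)
          moreover have "N div r < N" using N prime_gt_1_nat[OF r(1)] by (intro div_less_dividend) auto
          ultimately have "\<not> N dvd N div r" using dvd_imp_le by fastforce
          then show ?thesis using zk by simp
        qed
        ultimately show ?thesis by simp
      qed
      then have "poly (g M) (z ^ k) \<noteq> 0"
        using map_poly_of_int_dvd[OF Mdvd, where 'a = complex] unfolding g_def dvd_def by auto
      then show "poly (g Q) (z ^ k) = 0" using gQ[of "z ^ k"] zk[of N] by simp
    qed
    also have "\<dots> \<le> degree (g Q)" by (rule card_poly_roots_bound[OF gQ0])
    finally show ?thesis .
  qed
  define a where "a = poly Q (int q)"
  have "(real q - 1) ^ totient N \<le> (real q - 1) ^ degree (g Q)"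
    using q deg_ge by (intro power_increasing) auto
  also have "\<dots> \<le> norm (poly (g Q) (of_real (real q)))"
    using q by (intro norm_poly_ge_if_roots_in_unit_disc gQ0 roots norm_lead) auto
  also have "poly (g Q) (of_real (real q)) = of_int a"
    unfolding g_def a_def using poly_map_poly_of_int[of Q "int q", where 'a = complex] by simp
  finally have "real_of_int \<bar>a\<bar> \<ge> (real q - 1) ^ totient N" by simp
  moreover have "a dvd int q ^ N - 1"
  proof -
    have "poly (f N) (int q) = poly M (int q) * a" by (simp add: Q a_def)
    then show ?thesis by (simp add: f_def)
  qed
  \<comment> \<open>Since \<open>f (N div r)\<close> divides \<open>M\<close>, cancelling it from
    \<open>f N = M * Q\<close> leaves the geometric sum as a multiple of \<open>Q\<close>.\<close>
  moreover have "a dvd (\<Sum>i<r. (int q ^ (N div r)) ^ i)" if r: "prime r" "r dvd N" for r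
  proof -
    obtain M' where M': "M = f (N div r) * M'" using dvdM[OF r] unfolding dvd_def by blast
    have "f N = ([:0, 1:] ^ (N div r)) ^ r - 1" using r by (simp add: f_def flip: power_mult)
    also have "\<dots> = f (N div r) * (\<Sum>i<r. ([:0, 1:] ^ (N div r)) ^ i)"
      by (simp add: f_def power_diff_1_eq)
    finally have "f (N div r) * (M' * Q) = f (N div r) * (\<Sum>i<r. ([:0, 1:] ^ (N div r)) ^ i)"
      using Q M' by (simp add: mult.assoc)
    moreover have "N div r > 0" using r N by (auto simp: div_greater_zero_iff dvd_imp_le prime_gt_0_nat)
    ultimately have "M' * Q = (\<Sum>i<r. ([:0, 1:] ^ (N div r)) ^ i)" using f0 by simp
    then have "poly (M' * Q) (int q) = poly (\<Sum>i<r. ([:0, 1:] ^ (N div r)) ^ i) (int q)" by simp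
    then have "poly M' (int q) * a = (\<Sum>i<r. (int q ^ (N div r)) ^ i)"
      by (simp add: a_def poly_sum)
    then show ?thesis by (metis dvd_triv_right)
  qed
  ultimately show thesis by (rule that)
qed

text \<open>Modulo \<open>l\<^sup>2\<close> each power is linear in \<open>l * t\<close>, and for
  odd \<open>l\<close> the sum of the indices below \<open>l\<close> is itself a multiple of
  \<open>l\<close>, so the linear terms vanish. Hence a prime \<open>l > 2\<close> divides such a
  sum only once.\<close>

lemma sum_powers_cong_exponent_mod_square:
  fixes l t :: int and n :: nat
  assumes "odd n" "l = int n"
  shows "[(\<Sum>i<n. (1 + l * t) ^ i) = l] (mod l\<^sup>2)"
proof -
  have *: "[(1 + l * t) ^ i = 1 + int i * (l * t)] (mod l\<^sup>2)" for i
  proof (induction i)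
    case (Suc i)
    have "[(1 + l * t) * (1 + l * t) ^ i = (1 + l * t) * (1 + int i * (l * t))] (mod l\<^sup>2)"
      by (intro cong_mult Suc cong_refl)
    also have "(1 + l * t) * (1 + int i * (l * t)) = 1 + int (Suc i) * (l * t) + l\<^sup>2 * (int i * t\<^sup>2)"
      by (simp add: algebra_simps power2_eq_square)
    also have "[\<dots> = 1 + int (Suc i) * (l * t)] (mod l\<^sup>2)" by (simp add: cong_def)
    finally show ?case by simp
  qed simp
  have "[(\<Sum>i<n. (1 + l * t) ^ i) = (\<Sum>i<n. 1 + int i * (l * t))] (mod l\<^sup>2)"
    by (intro cong_sum *)
  also have "(\<Sum>i<n. 1 + int i * (l * t)) = l + (\<Sum>i<n. int i) * (l * t)"
    by (simp add: sum.distrib sum_distrib_right assms(2))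
  also have "(\<Sum>i<n. int i) = l * int ((n - 1) div 2)"
  proof -
    obtain m where m: "n = Suc (2 * m)" using assms(1) by (auto elim: oddE)
    have "(\<Sum>i<Suc (2 * m). int i) = int (Suc (2 * m)) * int m"
      by (induction m) (simp_all add: algebra_simps)
    then show ?thesis using m assms(2) by simp
  qed
  also have "l + l * int ((n - 1) div 2) * (l * t) = l + l\<^sup>2 * (int ((n - 1) div 2) * t)"
    by (simp add: algebra_simps power2_eq_square)
  also have "[\<dots> = l] (mod l\<^sup>2)" by (simp add: cong_def)
  finally show ?thesis .
qed

lemma int_dvd_power_minus_1_iff: "int p dvd int q ^ n - 1 \<longleftrightarrow> ord p q dvd n"
proof -
  have "int p dvd int q ^ n - 1 \<longleftrightarrow> [int (q ^ n) = int 1] (mod int p)"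
    by (simp add: cong_iff_dvd_diff)
  also have "\<dots> \<longleftrightarrow> [q ^ n = 1] (mod p)" by (rule cong_int_iff)
  also have "\<dots> \<longleftrightarrow> ord p q dvd n" by (rule ord_divides)
  finally show ?thesis .
qed

lemma less_three_power: "(p :: nat) \<ge> 2 \<Longrightarrow> p < 3 ^ (p - 1)"
proof (induction p rule: dec_induct)
  case (step p)
  have "Suc p < 3 * 3 ^ (p - 1)" using step by linarith
  also have "\<dots> = 3 ^ (Suc p - 1)" using step(1) by (cases p) auto
  finally show ?case .
qed simp

text \<open>A prime \<open>l\<close> dividing the cyclotomic value \<open>a\<close> whose
  order \<open>d\<close> is smaller than \<open>N\<close> divides \<open>N\<close>, is the largest prime factor of \<open>N\<close> (as \<open>d\<close> divides
  \<open>l - 1\<close>), and divides \<open>a\<close> only once. So without a primitive prime divisor \<open>a\<close> would be at most \<open>l\<close>.\<close>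

theorem zsigmondy:
  fixes q N :: nat
  assumes q: "q \<ge> 4" and N: "N \<ge> 3"
  shows "\<exists>p. prime p \<and> ord p q = N"
proof (rule ccontr)
  assume "\<not> ?thesis"
  then have none: "ord p q \<noteq> N" if "prime p" for p using that by blast
  obtain a :: int where a: "real_of_int \<bar>a\<bar> \<ge> (real q - 1) ^ totient N" "a dvd int q ^ N - 1"
    and a_dvd: "\<And>r. prime r \<Longrightarrow> r dvd N \<Longrightarrow> a dvd (\<Sum>i<r. (int q ^ (N div r)) ^ i)"
    using ex_cyclotomic_value[of N q] q N by auto
  define b where "b = nat \<bar>a\<bar>"
  have dvd_b: "int m dvd a" if "m dvd b" for m
    using that unfolding b_def by (metis dvd_abs_iff int_dvd_int_iff nat_0_le abs_ge_zero)
  have "3 ^ totient N \<le> (real q - 1) ^ totient N" using q by (intro power_mono) auto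
  also have "\<dots> \<le> real b" using a(1) by (simp add: b_def)
  finally have "real (3 ^ totient N) \<le> real b" by simp
  then have b_ge: "3 ^ totient N \<le> b" by (simp only: of_nat_le_iff)

  \<comment> \<open>If the order of \<open>q\<close> modulo \<open>l\<close> divides
    \<open>N div r\<close>, then each term of the geometric sum is 1 modulo \<open>l\<close>, so the
    sum is \<open>r\<close> modulo \<open>l\<close>; but \<open>a\<close>, and with it
    \<open>l\<close>, divides the sum.\<close>
  have eq_if: "r = l" if l: "prime l" "l dvd b" and r: "prime r" "r dvd N" "ord l q dvd N div r" for l r
  proof -
    have "int l dvd int q ^ (N div r) - 1" using r(3) by (simp add: int_dvd_power_minus_1_iff)
    then have 1: "[int q ^ (N div r) = 1] (mod int l)" by (simp add: cong_iff_dvd_diff)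
    have "[(\<Sum>i<r. (int q ^ (N div r)) ^ i) = (\<Sum>i<r. 1 ^ i)] (mod int l)"
      by (intro cong_sum cong_pow 1)
    moreover have "int l dvd (\<Sum>i<r. (int q ^ (N div r)) ^ i)"
      using dvd_b[OF l(2)] a_dvd[OF r(1,2)] by (rule dvd_trans)
    ultimately have "int l dvd int r" by (simp add: cong_dvd_iff)
    then show ?thesis using l(1) r(1) primes_dvd_imp_eq[of l r] by simp
  qed
  have facts: "l dvd N" "ord l q dvd N div l" "\<And>r. prime r \<Longrightarrow> r dvd N \<Longrightarrow> r \<noteq> l \<Longrightarrow> r < l"
    if l: "prime l" "l dvd b" for l
  proof -
    have "int l dvd int q ^ N - 1" using dvd_b[OF l(2)] a(2) by (rule dvd_trans)
    then have d: "ord l q dvd N" by (simp add: int_dvd_power_minus_1_iff)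
    then obtain m where m: "N = ord l q * m" by blast
    \<comment> \<open>As the order is a proper divisor of \<open>N\<close>, some prime
      \<open>r\<close> divides the quotient \<open>m\<close>, and \<open>eq_if\<close> identifies it
      with \<open>l\<close>.\<close>
    have "m \<noteq> 1" using m none[OF l(1)] by auto
    then obtain r where r: "prime r" "r dvd m" using prime_factor_nat by blast
    then obtain m' where m': "m = r * m'" by blast
    have "N div r = ord l q * m'" using m m' r(1) by (simp add: prime_gt_0_nat)
    then have r2: "r dvd N" "ord l q dvd N div r" using m m' by auto
    then have "r = l" using eq_if[OF l r(1)] by simp
    then show "l dvd N" "ord l q dvd N div l" using r2 by auto
    have "ord l q > 0" using m N by (intro Nat.gr0I) auto
    then have "coprime l q" by simp
    then have "[q ^ (l - 1) = 1] (mod l)" using l(1)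
      by (intro fermat_theorem) (auto simp: coprime_absorb_left)
    then have d1: "ord l q dvd l - 1" by (simp only: ord_divides)
    show "r < l" if r: "prime r" "r dvd N" "r \<noteq> l" for r
    proof -
      \<comment> \<open>Otherwise the order would divide \<open>N div r\<close>, and
        \<open>eq_if\<close> would give \<open>r = l\<close>.\<close>
      have "r dvd ord l q"
      proof (rule ccontr)
        assume "\<not> r dvd ord l q"
        then have "r dvd m" using r(1,2) m by (simp add: prime_dvd_mult_iff)
        then obtain m' where m': "m = r * m'" by blast
        have "N div r = ord l q * m'" using m m' r(1) by (simp add: prime_gt_0_nat)
        then show False using eq_if[OF l r(1,2)] r(3) by simp
      qed
      then have "r dvd l - 1" using d1 by (rule dvd_trans)
      then have "r \<le> l - 1" using prime_gt_1_nat[OF l(1)] by (intro dvd_imp_le) auto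
      then show ?thesis using prime_gt_1_nat[OF l(1)] by simp
    qed
  qed
  have not_square: "\<not> l\<^sup>2 dvd b" if l: "prime l" "l dvd b" for l
  proof
    assume "l\<^sup>2 dvd b"
    then have sq: "(int l)\<^sup>2 dvd (\<Sum>i<l. (int q ^ (N div l)) ^ i)"
      using dvd_b[of "l\<^sup>2"] a_dvd[OF l(1) facts(1)[OF l]] by (simp add: dvd_trans)
    have "int l dvd int q ^ (N div l) - 1"
      using facts(2)[OF l] by (simp add: int_dvd_power_minus_1_iff)
    then obtain t where "int q ^ (N div l) - 1 = int l * t" by blast
    then have t: "int q ^ (N div l) = 1 + int l * t" by simp
    show False
    proof (cases "odd l")
      case True
      then have "[(\<Sum>i<l. (int q ^ (N div l)) ^ i) = int l] (mod (int l)\<^sup>2)"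
        unfolding t by (rule sum_powers_cong_exponent_mod_square) simp
      then have "(int l)\<^sup>2 dvd int l" using sq by (simp add: cong_dvd_iff)
      then have "l\<^sup>2 dvd l" by (metis int_dvd_int_iff of_nat_power)
      then have "l * l \<le> l" using prime_gt_0_nat[OF l(1)] by (auto dest: dvd_imp_le simp: power2_eq_square)
      then show False using prime_gt_1_nat[OF l(1)] by simp
    next
      \<comment> \<open>For \<open>l = 2\<close> the largest prime factor of \<open>N\<close> is 2,
        so \<open>N div 2\<close> is even. The geometric sum is then 1 plus the square of an odd
        number, which is 2 modulo 4.\<close>
      case False
      then have l2: "l = 2" using l(1) by (metis prime_odd_nat prime_ge_2_nat le_neq_implies_less)
      have "even (N div 2)"
      proof (rule ccontr)
        assume odd: "odd (N div 2)"
        have "N div 2 \<noteq> 1" using facts(1)[OF l] N l2 by auto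
        then obtain r where r: "prime r" "r dvd N div 2" using prime_factor_nat by blast
        have "r \<noteq> 2" using r odd by auto
        moreover have "r dvd N" using r(2) facts(1)[OF l] l2 by (metis dvd_div_mult_self dvd_mult2)
        ultimately have "r < 2" using facts(3)[OF l r(1)] l2 by simp
        then show False using prime_ge_2_nat[OF r(1)] by simp
      qed
      then obtain k where k: "N div 2 = 2 * k" by blast
      have oddy: "odd (int q ^ k)"
      proof
        assume "even (int q ^ k)"
        then have "even (int q ^ (N div 2))" unfolding k mult_2 power_add by simp
        then show False using t unfolding l2 by simp
      qed
      have "4 dvd 1 + (int q ^ k)\<^sup>2"
        using sq unfolding l2 k by (simp add: numeral_2_eq_2 power_add)
      moreover obtain u where "int q ^ k = 2 * u + 1" using oddy by (rule oddE)
      ultimately have "4 dvd 4 * (u\<^sup>2 + u) + 2" by (simp add: power2_eq_square algebra_simps)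
      then show False by presburger
    qed
  qed
  have "b > 1"
  proof -
    have "totient N > 0" using N by simp
    then have "1 \<le> totient N" by linarith
    then have "(3::nat) ^ 1 \<le> 3 ^ totient N" by (rule power_increasing) simp
    then show ?thesis using b_ge by simp
  qed
  then obtain l where l: "prime l" "l dvd b" using prime_factor_nat[of b] by auto
  then obtain m where m: "b = l * m" by blast
  \<comment> \<open>Two different prime factors of \<open>b\<close> would each have to be smaller
    than the other, and a repeated one is excluded by \<open>not_square\<close>.\<close>
  have "m = 1"
  proof (rule ccontr)
    assume "m \<noteq> 1"
    then obtain r where r: "prime r" "r dvd m" using prime_factor_nat by blast
    then have "r dvd b" using m by simp
    have "r = l"
    proof (rule ccontr)
      assume "r \<noteq> l"
      then have "r < l" "l < r"
        using facts(3)[OF l r(1)] facts(1)[OF r(1) \<open>r dvd b\<close>]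
          facts(3)[OF r(1) \<open>r dvd b\<close> l(1)] facts(1)[OF l] by auto
      then show False by simp
    qed
    then have "l\<^sup>2 dvd b" using m r(2) by (auto simp: power2_eq_square)
    then show False using not_square[OF l] by simp
  qed
  then have "b = l" using m by simp
  \<comment> \<open>Since \<open>l\<close> divides \<open>N\<close>, this bounds
    \<open>totient N\<close> below by \<open>l - 1\<close>, so \<open>b = l\<close> would be at
    least \<open>3 ^ (l - 1)\<close>.\<close>
  have "l - 1 = totient l" using l(1) by (simp add: totient_prime)
  also have "totient l dvd totient N" using facts(1)[OF l] by (rule totient_dvd)
  then have "totient l \<le> totient N" using N by (intro dvd_imp_le) auto
  finally have "3 ^ (l - 1) \<le> (3::nat) ^ totient N" by (intro power_increasing) auto
  then show False using b_ge \<open>b = l\<close> less_three_power[OF prime_ge_2_nat[OF l(1)]] by linarith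
qed

section \<open>Comparing products of numbers \<open>q ^ n - 1\<close>\<close>

lemma dvd_power_minus_1_iff:
  assumes "(q :: nat) > 0"
  shows "p dvd q ^ n - 1 \<longleftrightarrow> ord p q dvd n"
proof -
  have "int (q ^ n - 1) = int q ^ n - 1" using assms by (subst of_nat_diff) auto
  then show ?thesis using int_dvd_power_minus_1_iff[of p q n] by (metis int_dvd_int_iff)
qed

lemma ex_odd_prime_factor:
  assumes "odd m" "m \<noteq> (1 :: nat)"
  obtains p where "prime p" "odd p" "p dvd m"
  using prime_factor_nat[OF assms(2)] assms(1) dvd_trans by blast

text \<open>For even \<open>q\<close> the number \<open>q - 1\<close> is odd. For odd
  \<open>q\<close> one of \<open>q - 1\<close> and \<open>q + 1\<close> is 2 modulo 4, so its half
  is odd. The bound on \<open>q\<close> keeps these odd numbers above 1; at \<open>q = 3\<close> the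
  half would be 1.\<close>

lemma ex_odd_prime_dvd_pred_or_succ:
  assumes "(q :: nat) \<ge> 4"
  obtains p where "prime p" "odd p" "p dvd q - 1 \<or> p dvd q + 1"
proof -
  have "q mod 2 = 0 \<or> q mod 4 = 1 \<or> q mod 4 = 3" by presburger
  then consider "q mod 2 = 0" | "q mod 4 = 1" | "q mod 4 = 3" by (elim disjE)
  then show thesis
  proof cases
    case 1
    then have "odd (q - 1)" "q - 1 \<noteq> 1" using assms by presburger+
    then show thesis using that by (metis ex_odd_prime_factor)
  next
    case 2
    then have "odd ((q + 1) div 2)" "(q + 1) div 2 \<noteq> 1" "q + 1 = 2 * ((q + 1) div 2)"
      using assms by presburger+
    then show thesis using that by (metis ex_odd_prime_factor dvd_mult)
  next
    case 3
    then have "odd ((q - 1) div 2)" "(q - 1) div 2 \<noteq> 1" "q - 1 = 2 * ((q - 1) div 2)"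
      using assms by presburger+
    then show thesis using that by (metis ex_odd_prime_factor dvd_mult)
  qed
qed

lemma odd_not_dvd_pred_and_succ:
  assumes "odd p" "prime p" "p dvd q - 1" "(q :: nat) > 0"
  shows "\<not> p dvd q + 1"
proof
  assume "p dvd q + 1"
  then have "p dvd (q + 1) - (q - 1)" using assms(3) by (rule dvd_diff_nat)
  then have "p dvd 2" using assms(4) by simp
  then show False using assms(1,2) primes_dvd_imp_eq[of p 2] by auto
qed

lemma multiplicity_power_mult_eqD:
  fixes x y :: nat
  assumes "prime p" "p dvd x" "\<not> p dvd y" "x ^ s * y ^ b = x ^ s' * y ^ b'" "x > 0"
  shows "s = s'"
proof -
  have y: "y > 0" using assms(3) by (intro Nat.gr0I) auto
  have *: "multiplicity p (x ^ s * y ^ b) = s * multiplicity p x" for s b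
    using assms(1,3,5) y
    by (simp add: prime_elem_multiplicity_mult_distrib prime_elem_multiplicity_power_distrib
        not_dvd_imp_multiplicity_0)
  have "multiplicity p x > 0" using assms(1,2,5) by (simp add: prime_multiplicity_gt_zero_iff)
  then show ?thesis using *[of s b] *[of s' b'] assms(4) by simp
qed

lemma multiset_le_2_eq_replicate:
  assumes "\<And>n. n \<in># A \<Longrightarrow> n = 1 \<or> n = (2::nat)"
  obtains a b where "A = replicate_mset a 1 + replicate_mset b 2"
proof
  show "A = replicate_mset (count A 1) 1 + replicate_mset (count A 2) 2"
  proof (rule multiset_eqI)
    fix n
    show "count A n = count (replicate_mset (count A 1) 1 + replicate_mset (count A 2) 2) n"
      using assms[of n] count_eq_zero_iff[of A n] by (cases "n = 1"; cases "n = 2") auto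
  qed
qed

text \<open>The exponents 1 and 2 may lack a primitive prime divisor, but both factors \<open>q - 1\<close> and
  \<open>q\<^sup>2 - 1\<close> contain \<open>q - 1\<close> once, so that any odd prime dividing exactly one of \<open>q - 1\<close>
  and \<open>q + 1\<close> still determines the number of factors.\<close>

lemma size_eq_if_prod_power_minus_1_eq_small:
  fixes q :: nat
  assumes q: "q \<ge> 4"
    and AB: "\<And>n. n \<in># A + B \<Longrightarrow> n = 1 \<or> n = 2"
    and eq: "(\<Prod>n\<in>#A. q ^ n - 1) = (\<Prod>n\<in>#B. q ^ n - 1)"
  shows "size A = size B"
proof -
  obtain a b where A: "A = replicate_mset a 1 + replicate_mset b 2"
    using multiset_le_2_eq_replicate[of A] AB by auto
  obtain c d where B: "B = replicate_mset c 1 + replicate_mset d 2"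
    using multiset_le_2_eq_replicate[of B] AB by auto
  have "q\<^sup>2 - 1 = (q - 1) * (q + 1)" by (simp add: algebra_simps power2_eq_square)
  then have "(q\<^sup>2 - 1) ^ b = (q - 1) ^ b * (q + 1) ^ b" for b by (simp only: power_mult_distrib)
  \<comment> \<open>The exponent of \<open>q - 1\<close> is the number of factors, so it suffices to
    compare these exponents.\<close>
  then have prod: "(\<Prod>n\<in>#replicate_mset a 1 + replicate_mset b 2. q ^ n - 1) =
      (q - 1) ^ (a + b) * (q + 1) ^ b" for a b
    by (simp add: power_add)
  have eq': "(q - 1) ^ (a + b) * (q + 1) ^ b = (q - 1) ^ (c + d) * (q + 1) ^ d"
    using eq unfolding A B prod .
  obtain p where p: "prime p" "odd p" "p dvd q - 1 \<or> p dvd q + 1"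
    using ex_odd_prime_dvd_pred_or_succ[OF q] by blast
  have "a + b = c + d"
  proof (cases "p dvd q - 1")
    case True
    then have "\<not> p dvd q + 1" using odd_not_dvd_pred_and_succ[OF p(2,1)] q by simp
    then show ?thesis using multiplicity_power_mult_eqD[OF p(1) True _ eq'] q by simp
  next
    case False
    then have "p dvd q + 1" using p(3) by simp
    moreover have "(q + 1) ^ b * (q - 1) ^ (a + b) = (q + 1) ^ d * (q - 1) ^ (c + d)"
      using eq' by (simp only: mult.commute)
    \<comment> \<open>Here \<open>p\<close> determines the exponent of \<open>q + 1\<close> instead;
      cancelling that power leaves equal powers of \<open>q - 1\<close>.\<close>
    ultimately have "b = d" using multiplicity_power_mult_eqD[OF p(1) _ False, of "q + 1"] by simp
    then have "(q - 1) ^ (a + b) = (q - 1) ^ (c + d)" using eq' by simp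
    then show ?thesis using q by (subst (asm) power_inject_exp) auto
  qed
  then show ?thesis using A B by simp
qed

text \<open>If the largest exponent \<open>N\<close> is at least 3, a prime of order
  \<open>N\<close> divides no factor with a smaller exponent. So \<open>N\<close> occurs on both
  sides, and one copy of its factor can be cancelled from each.\<close>

lemma size_eq_if_prod_power_minus_1_eq:
  fixes q :: nat
  assumes q: "q \<ge> 4"
    and "\<And>n. n \<in># A + B \<Longrightarrow> n > 0"
    and "(\<Prod>n\<in>#A. q ^ n - 1) = (\<Prod>n\<in>#B. q ^ n - 1)"
  shows "size A = size B"
  using assms(2,3)
proof (induction "size A" arbitrary: A B rule: less_induct)
  case less
  show ?case
  proof (cases "\<forall>n\<in>#A + B. n \<le> 2")
    case True
    have "n = 1 \<or> n = 2" if "n \<in># A + B" for n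
    proof -
      have "n > 0" "n \<le> 2" using less.prems(1)[OF that] True that by blast+
      then show ?thesis by linarith
    qed
    then show ?thesis using size_eq_if_prod_power_minus_1_eq_small[OF q _ less.prems(2)] by blast
  next
    case False
    define N where "N = Max (set_mset (A + B))"
    have max: "n \<le> N" if "n \<in># A + B" for n unfolding N_def using that by (intro Max_ge) auto
    have "A + B \<noteq> {#}" using False by auto
    then have N_in: "N \<in># A + B" unfolding N_def by (intro Max_in) auto
    have "N \<ge> 3" using False max by fastforce
    then obtain p where p: "prime p" "ord p q = N" using zsigmondy[OF q] by blast
    have dvd_iff: "p dvd q ^ n - 1 \<longleftrightarrow> n = N" if "n \<in># A + B" for n
      using dvd_power_minus_1_iff[of q p n] q p(2) max[OF that] less.prems(1)[OF that]
      by (auto dest: dvd_imp_le)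
    have prod_iff: "p dvd (\<Prod>n\<in>#C. q ^ n - 1) \<longleftrightarrow> N \<in># C" if "C \<subseteq># A + B" for C
    proof -
      have "p dvd (\<Prod>n\<in>#C. q ^ n - 1) \<longleftrightarrow> (\<exists>n\<in>#C. p dvd q ^ n - 1)"
        using p(1) by (simp add: prime_dvd_prod_mset_iff)
      also have "\<dots> \<longleftrightarrow> (\<exists>n\<in>#C. n = N)" using dvd_iff mset_subset_eqD[OF that] by blast
      finally show ?thesis by simp
    qed
    have "N \<in># A \<longleftrightarrow> N \<in># B" using prod_iff[of A] prod_iff[of B] less.prems(2) by simp
    then have "N \<in># A" "N \<in># B" using N_in by auto
    then obtain A' B' where A': "A = add_mset N A'" and B': "B = add_mset N B'"
      by (meson multi_member_split)
    have "q ^ 1 < q ^ N" using q \<open>N \<ge> 3\<close> by (intro power_strict_increasing) auto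
    then have "q ^ N - 1 > 0" using q by simp
    then have "(\<Prod>n\<in>#A'. q ^ n - 1) = (\<Prod>n\<in>#B'. q ^ n - 1)"
      using less.prems(2) by (simp add: A' B')
    moreover have "n > 0" if "n \<in># A' + B'" for n
      using less.prems(1)[of n] that by (auto simp: A' B')
    ultimately have "size A' = size B'" using less.hyps[of A' B'] by (simp add: A')
    then show ?thesis by (simp add: A' B')
  qed
qed

subsection \<open>The equation \<open>\<phi>(F) = \<sigma>(G)\<close>\<close>

lemma phi_eq_sigma_imp_eq_1:
  fixes F G :: "'a::{field,finite} poly"
  assumes q: "CARD('a) \<ge> 4" and monic: "lead_coeff F = 1" "lead_coeff G = 1"
    and eq: "poly_phi F = poly_sigma G"
  shows "F = 1 \<and> G = 1"
proof -
  obtain s K where K: "poly_phi F = CARD('a) ^ s * (\<Prod>n\<in>#K. CARD('a) ^ n - 1)"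
    "\<forall>n\<in>#K. n > 0" "K = {#} \<longrightarrow> F = 1"
    using poly_phi_eq_prod[OF monic(1)] by blast
  obtain A B where AB: "poly_sigma G * (\<Prod>n\<in>#A. CARD('a) ^ n - 1) = (\<Prod>n\<in>#B. CARD('a) ^ n - 1)"
    "\<forall>n\<in>#A + B. n > 0" "size A = size B"
    using poly_sigma_eq_prod_quotient[OF monic(2)] by blast
  have "G \<noteq> 0" using monic(2) by auto
  then obtain m where m: "poly_sigma G = 1 + CARD('a) * m" by (rule poly_sigma_cong_1)
  have "s = 0"
  proof (rule ccontr)
    assume "s \<noteq> 0"
    then have "CARD('a) dvd poly_phi F" using K(1) by (simp add: dvd_power)
    then have "CARD('a) dvd 1 + CARD('a) * m" using eq m by simp
    then have "CARD('a) dvd 1" using dvd_add_left_iff[of "CARD('a)" "CARD('a) * m" 1] by simp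
    then show False using q by simp
  qed
  \<comment> \<open>With the denominators of sigma moved to the side of phi, equal sizes of
    \<open>K + A\<close> and \<open>B\<close>, together with \<open>size A = size B\<close>, leave
    \<open>K\<close> empty.\<close>
  then have "(\<Prod>n\<in>#K + A. CARD('a) ^ n - 1) = (\<Prod>n\<in>#B. CARD('a) ^ n - 1)"
    using K(1) AB(1) eq by simp
  moreover have "n > 0" if "n \<in># (K + A) + B" for n using that K(2) AB(2) by auto
  ultimately have "size (K + A) = size B" using size_eq_if_prod_power_minus_1_eq[OF q] by blast
  then have "F = 1" using AB(3) K(3) by simp
  then show ?thesis using eq poly_sigma_eq_1_iff[OF monic(2)] by simp
qed

theorem theorem1p1:
  fixes q :: nat
  assumes "CARD('a :: {field,finite}) = q"
  shows "(q = 2 \<or> q = 3 \<longrightarrow>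
            infinite {(F, G) :: 'a poly \<times> 'a poly |F G.
              F \<noteq> 0 \<and> G \<noteq> 0 \<and> lead_coeff F = 1 \<and> lead_coeff G = 1 \<and> poly_phi F = poly_sigma G}) \<and>
         (q \<noteq> 2 \<and> q \<noteq> 3 \<longrightarrow>
            {(F, G) :: 'a poly \<times> 'a poly |F G.
              F \<noteq> 0 \<and> G \<noteq> 0 \<and> lead_coeff F = 1 \<and> lead_coeff G = 1 \<and> poly_phi F = poly_sigma G}
            = {(1, 1)})"
proof (intro conjI impI)
  assume "q = 2 \<or> q = 3"
  then show "infinite {(F, G) :: 'a poly \<times> 'a poly |F G.
      F \<noteq> 0 \<and> G \<noteq> 0 \<and> lead_coeff F = 1 \<and> lead_coeff G = 1 \<and> poly_phi F = poly_sigma G}"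
    using assms infinite_phi_sigma_pairs_card_2 infinite_phi_sigma_pairs_card_3 by blast
next
  assume "q \<noteq> 2 \<and> q \<noteq> 3"
  then have "CARD('a) \<ge> 4" using assms card_field_ge_2[where 'a = 'a] by linarith
  then show "{(F, G) :: 'a poly \<times> 'a poly |F G.
      F \<noteq> 0 \<and> G \<noteq> 0 \<and> lead_coeff F = 1 \<and> lead_coeff G = 1 \<and> poly_phi F = poly_sigma G} = {(1, 1)}"
    using phi_eq_sigma_imp_eq_1[where 'a = 'a] by auto
qed

end
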